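(* Let $F$ be a field. Suppose $L=\{\alpha_1,\dotsc,\alpha_k\}\subset F$ and $L'=\{\alpha_1',\dotsc,\alpha_k'\}\subset F$ are sets of the same size $k$, with $0\notin L$ and $0\notin L'$. If $L$ and $L'$ (with these orderings of their elements) satisfy the same set of primitive linear relations, then for every $r$ we have $N(r,L)\leq N(2kr,L')$, and similarly $N(r,L')\leq N(2kr,L)$.
   Context: For a subset $L$ of a field $F$, an $L$-matrix is a square matrix over $F$ whose diagonal entries are all $0$ and each of whose off-diagonal entries belongs to $L$. $N(r,L)$ is the maximum $n$ such that there exists an $n\times n$ $L$-matrix of rank at most $r$. A primitive linear relation on $L=\{\alpha_1,\dotsc,\alpha_k\}$ is a tuple $(A_1,\dotsc,A_k)\in\mathbb{Z}^k$ with $A_1\alpha_1+\dotsb+A_k\alpha_k=0$ (in $F$) and $A_1+\dotsb+A_k=1$ (in $\mathbb{Z}$). *)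

theory Defs
  imports "Jordan_Normal_Form.DL_Rank" "HOL-Library.FuncSet"
begin

definition L_matrix :: "'a::field set \<Rightarrow> nat \<Rightarrow> 'a mat \<Rightarrow> bool" where
  "L_matrix L n A \<longleftrightarrow>
     A \<in> carrier_mat n n \<and>
     (\<forall>i<n. A $$ (i, i) = 0) \<and>
     (\<forall>i<n. \<forall>j<n. i \<noteq> j \<longrightarrow> A $$ (i, j) \<in> L)"

definition L_matrix_sizes :: "nat \<Rightarrow> 'a::field set \<Rightarrow> nat set" where
  "L_matrix_sizes r L = {n. \<exists>A. L_matrix L n A \<and> vec_space.rank n A \<le> r}"

text \<open>The maximum is only meaningful if the set of sizes is finite and nonempty;
  \<open>finite_L_matrix_sizes\<close> and \<open>L_matrix_sizes_nonempty\<close> below show that this is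
  the case whenever \<open>L\<close> is finite and \<open>0 \<notin> L\<close>.\<close>

definition N :: "nat \<Rightarrow> 'a::field set \<Rightarrow> nat" where
  "N r L = Max (L_matrix_sizes r L)"

text \<open>The tuple \<open>(\<alpha>\<^sub>1, \<dots>, \<alpha>\<^sub>k)\<close> is indexed from 0, as \<open>\<alpha> 0, \<dots>, \<alpha> (k - 1)\<close>. Elements of
  \<open>\<int>\<^sup>k\<close> are represented by functions that are \<open>undefined\<close> outside \<open>{..<k}\<close>.\<close>

definition primitive_relations :: "nat \<Rightarrow> (nat \<Rightarrow> 'a::field) \<Rightarrow> (nat \<Rightarrow> int) set" where
  "primitive_relations k \<alpha> =
     {A \<in> {..<k} \<rightarrow>\<^sub>E UNIV. (\<Sum>i<k. of_int (A i) * \<alpha> i) = 0 \<and> (\<Sum>i<k. A i) = 1}"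

lemma L_matrix_sizes_nonempty: "0 \<in> L_matrix_sizes r L"
proof -
  have "L_matrix L 0 (0\<^sub>m 0 0)"
    by (simp add: L_matrix_def)
  moreover have "vec_space.rank 0 (0\<^sub>m 0 0 :: 'a mat) \<le> 0"
    by (rule vec_space.rank_le_nc) simp
  ultimately show ?thesis
    unfolding L_matrix_sizes_def by (auto intro: exI[of _ "0\<^sub>m 0 0"])
qed

lemma L_matrix_size_bound:
  fixes L :: "'a::field set"
  assumes "finite L" "0 \<notin> L" "n \<in> L_matrix_sizes r L"
  shows "n \<le> (card L + 1) ^ r"
proof -
  obtain A where A: "L_matrix L n A" and rk: "vec_space.rank n A \<le> r"
    using assms(3) by (auto simp: L_matrix_sizes_def)
  interpret vec_space "TYPE('a)" n .
  have Ac: "A \<in> carrier_mat n n" using A by (simp add: L_matrix_def)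
  have colsc: "set (cols A) \<subseteq> carrier_vec n" using Ac cols_dim by blast
  obtain S where S: "finite S" "maximal S (\<lambda>T. T \<subseteq> set (cols A) \<and> lin_indpt T)"
    using maximal_exists_superset[of "set (cols A)" "\<lambda>T. T \<subseteq> set (cols A) \<and> lin_indpt T" "{}"]
      finite_lin_indpt2 by auto
  have Sc: "S \<subseteq> set (cols A)" "lin_indpt S" "S \<subseteq> carrier_vec n"
    using S(2) colsc by (auto simp: maximal_def)
  have cardS: "card S \<le> r" using rank_card_indpt[OF Ac S(2)] rk by simp
  have in_span: "c \<in> span S" if c: "c \<in> set (cols A)" for c
  proof (rule ccontr)
    assume nc: "c \<notin> span S"
    then have "c \<notin> S" using span_mem[OF Sc(3)] by blast
    then have "lin_indpt (S \<union> {c})"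
      using lin_dep_iff_in_span[OF Sc(3,2)] c colsc nc by blast
    then have "S \<union> {c} = S" using S(2) c Sc(1) unfolding maximal_def by blast
    with \<open>c \<notin> S\<close> show False by blast
  qed
  let ?f = "\<lambda>i. restrict (\<lambda>s. s $ i) S"
  have "inj_on ?f {..<n}"
  proof (rule inj_onI)
    fix i j assume ij: "i \<in> {..<n}" "j \<in> {..<n}" and eq: "?f i = ?f j"
    have eqS: "s $ i = s $ j" if "s \<in> S" for s
      using fun_cong[OF eq, of s] that by simp
    have eqc: "c $ i = c $ j" if c: "c \<in> set (cols A)" for c
    proof -
      obtain a where a: "c = lincomb a S"
        using in_span[OF c] finite_span[OF S(1) Sc(3)] by blast
      show ?thesis
        using ij eqS by (simp add: a lincomb_index[OF _ Sc(3)] cong: sum.cong)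
    qed
    have "col A i \<in> set (cols A)" using ij Ac by (auto simp: cols_def)
    from eqc[OF this] have "A $$ (i, i) = A $$ (j, i)" using ij Ac by simp
    then show "i = j" using A ij assms(2) unfolding L_matrix_def
      by (metis lessThan_iff)
  qed
  moreover have "?f ` {..<n} \<subseteq> S \<rightarrow>\<^sub>E insert 0 L"
  proof -
    have "s $ i \<in> insert 0 L" if si: "i < n" "s \<in> S" for s i
    proof -
      obtain j where j: "j < n" "s = col A j"
        using si(2) Sc(1) Ac by (auto simp: cols_def)
      then show ?thesis using A si Ac unfolding L_matrix_def by (cases "i = j") auto
    qed
    then show ?thesis by (intro image_subsetI restrict_PiE_iff[THEN iffD2]) blast
  qed
  ultimately have "card {..<n} \<le> card (S \<rightarrow>\<^sub>E insert 0 L)"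
    by (rule card_inj_on_le) (simp add: S(1) assms(1) finite_PiE)
  also have "\<dots> = (card L + 1) ^ card S"
    using assms(1,2) by (simp add: card_PiE[OF S(1)])
  also have "\<dots> \<le> (card L + 1) ^ r" using cardS by (intro power_increasing) auto
  finally show ?thesis by simp
qed

lemma finite_L_matrix_sizes:
  assumes "finite L" "0 \<notin> L"
  shows "finite (L_matrix_sizes r L)"
  using L_matrix_size_bound[OF assms] by (meson finite_nat_set_iff_bounded_le)

end

theory Submission
  imports Defs
begin

text \<open>Let \<open>A\<close> be an \<open>L\<close>-matrix of rank \<open>r\<close>, and pick \<open>r\<close> rows that span its row space. Splitting
  each entry according to its value in \<open>L\<close> turns the part of a column lying in these rows into an
  integer vector of length \<open>k r\<close>. Hence more than \<open>k r\<close> columns admit an integer relation with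
  coprime coefficients \<open>x\<^sub>j\<close> that annihilates these rows of \<open>A\<close>, and therefore all rows of \<open>A\<close>. In
  row \<open>i\<close> it reads \<open>\<Sum>\<^sub>t (\<Sum>\<^sub>j x\<^sub>j [A\<^sub>i\<^sub>j = \<alpha>\<^sub>t]) \<alpha>\<^sub>t = 0\<close>, an integer relation on \<open>L\<close>.

  If \<open>L\<close> has a primitive relation, then the primitive relations of \<open>L\<close> generate all integer
  relations, so that \<open>L\<close> and \<open>L'\<close> satisfy the same ones, and replacing \<open>\<alpha>\<^sub>t\<close> by \<open>\<alpha>'\<^sub>t\<close> in \<open>A\<close> gives
  a matrix of rank at most \<open>k r\<close>. If there is no primitive relation, then \<open>A\<close> has size at most
  \<open>k r + 1\<close>: otherwise the \<open>x\<^sub>j\<close> could be chosen with sum 0, so that the coefficients of the relation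
  from row \<open>i\<close> add up to \<open>- x\<^sub>i\<close>, and a Bezout combination of these relations would be primitive.\<close>

section \<open>Homogeneous linear systems and coprime integer solutions\<close>

text \<open>Elimination by cross-multiplication with a pivot needs no division, so one argument
  serves both the integers and the field.\<close>

lemma homogeneous_system_solution:
  fixes a :: "'i \<Rightarrow> 't \<Rightarrow> 'b::idom"
  assumes "finite T" "finite S" "card T < card S"
  shows "\<exists>x. (\<exists>i\<in>S. x i \<noteq> 0) \<and> (\<forall>t\<in>T. (\<Sum>i\<in>S. x i * a i t) = 0)"
  using assms
proof (induction T arbitrary: S a rule: finite_induct)
  case empty
  then have "S \<noteq> {}" by auto
  then show ?case by (intro exI[of _ "\<lambda>_. 1"]) auto
next
  case (insert u T)
  show ?case
  proof (cases "\<forall>i\<in>S. a i u = 0")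
    case True
    have "card T < card S" using insert by simp
    from insert.IH[OF insert.prems(1) this] True show ?thesis by auto
  next
    case False
    then obtain p where p: "p \<in> S" "a p u \<noteq> 0" by auto
    define b where "b i t = a p u * a i t - a i u * a p t" for i t
    have "card T < card (S - {p})" using insert p by simp
    from insert.IH[OF _ this, of b] insert.prems(1)
    obtain y where y: "\<exists>i\<in>S - {p}. y i \<noteq> 0" "\<And>t. t \<in> T \<Longrightarrow> (\<Sum>i\<in>S - {p}. y i * b i t) = 0"
      by auto
    \<comment> \<open>The value at \<open>p\<close> is forced by equation \<open>u\<close> once all
      other values are scaled by the pivot; as there are no zero divisors, the scaling keeps a
      nonzero value nonzero.\<close>
    define x where "x i = (if i = p then - (\<Sum>i\<in>S - {p}. y i * a i u) else a p u * y i)" for i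
    have "(\<Sum>i\<in>S. x i * a i t) = (\<Sum>i\<in>S - {p}. y i * b i t)" for t
    proof -
      have "(\<Sum>i\<in>S. x i * a i t) = x p * a p t + (\<Sum>i\<in>S - {p}. x i * a i t)"
        using insert.prems(1) p by (simp add: sum.remove)
      also have "(\<Sum>i\<in>S - {p}. x i * a i t) = (\<Sum>i\<in>S - {p}. a p u * y i * a i t)"
        by (intro sum.cong) (auto simp: x_def)
      also have "x p * a p t = - (\<Sum>i\<in>S - {p}. y i * a i u * a p t)"
        by (simp add: x_def sum_distrib_right)
      finally show ?thesis
        by (simp add: b_def algebra_simps sum_subtractf)
    qed
    moreover have "b i u = 0" for i by (simp add: b_def)
    ultimately have "\<forall>t\<in>insert u T. (\<Sum>i\<in>S. x i * a i t) = 0" using y(2) by auto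
    moreover have "\<exists>i\<in>S. x i \<noteq> 0"
    proof -
      obtain i where "i \<in> S - {p}" "y i \<noteq> 0" using y(1) by blast
      then show ?thesis using p(2) by (intro bexI[of _ i]) (auto simp: x_def)
    qed
    ultimately show ?thesis by blast
  qed
qed

lemma bezout_Gcd_int:
  fixes f :: "'i \<Rightarrow> int"
  assumes "finite S"
  shows "\<exists>c. (\<Sum>i\<in>S. c i * f i) = Gcd (f ` S)"
  using assms
proof induction
  case empty
  show ?case by simp
next
  case (insert j S)
  then obtain c where c: "(\<Sum>i\<in>S. c i * f i) = Gcd (f ` S)" by auto
  obtain u v where uv: "u * f j + v * Gcd (f ` S) = gcd (f j) (Gcd (f ` S))"
    using bezout_int by blast
  have "(\<Sum>i\<in>S. (if i = j then u else v * c i) * f i) = (\<Sum>i\<in>S. v * (c i * f i))"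
    using insert.hyps by (intro sum.cong) (auto simp: mult.assoc)
  then have "(\<Sum>i\<in>insert j S. (if i = j then u else v * c i) * f i) = Gcd (f ` insert j S)"
    using insert.hyps uv c by (simp add: sum_distrib_left[symmetric])
  then show ?case by (rule exI[where x = "\<lambda>i. if i = j then u else v * c i"])
qed

text \<open>A nonzero solution is divided by its gcd, and the Bezout coefficients \<open>c\<close>
  certify coprimality. Unlike mere non-vanishing, the identity with value 1 survives the passage to
  a field of positive characteristic.\<close>

lemma integer_system_coprime_solution:
  fixes a :: "'i \<Rightarrow> 't \<Rightarrow> int"
  assumes "finite T" "finite S" "card T < card S"
  obtains x c where "\<And>t. t \<in> T \<Longrightarrow> (\<Sum>i\<in>S. x i * a i t) = 0" "(\<Sum>i\<in>S. c i * x i) = 1"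
proof -
  obtain y where y: "\<exists>i\<in>S. y i \<noteq> 0" "\<And>t. t \<in> T \<Longrightarrow> (\<Sum>i\<in>S. y i * a i t) = 0"
    using homogeneous_system_solution[OF assms, of a] by auto
  define g where "g = Gcd (y ` S)"
  obtain c where c: "(\<Sum>i\<in>S. c i * y i) = g"
    using bezout_Gcd_int[OF assms(2)] g_def by metis
  have g0: "g \<noteq> 0" using y(1) by (auto simp: g_def Gcd_0_iff)
  have yg: "y i = g * (y i div g)" if "i \<in> S" for i
    using that by (simp add: g_def Gcd_dvd)
  show thesis
  proof (rule that[of "\<lambda>i. y i div g" c])
    fix t assume "t \<in> T"
    have "g * (\<Sum>i\<in>S. y i div g * a i t) = (\<Sum>i\<in>S. y i * a i t)"
      unfolding sum_distrib_left using yg by (intro sum.cong) (auto simp: mult.assoc[symmetric])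
    then show "(\<Sum>i\<in>S. y i div g * a i t) = 0" using y(2)[OF \<open>t \<in> T\<close>] g0 by simp
  next
    have "g * (\<Sum>i\<in>S. c i * (y i div g)) = (\<Sum>i\<in>S. c i * y i)"
      unfolding sum_distrib_left using yg
      by (intro sum.cong) (auto simp: mult.left_commute[of g])
    then show "(\<Sum>i\<in>S. c i * (y i div g)) = 1" using c g0 by simp
  qed
qed

section \<open>Spanning rows and independent columns of a matrix\<close>

text \<open>In a spanning subfamily of least size, more than \<open>card C\<close> members would
  satisfy a nontrivial linear relation, and a member with nonzero coefficient could be dropped. This
  is what bounds row rank by column rank below.\<close>

lemma small_spanning_subfamily:
  fixes f :: "'i \<Rightarrow> 'c \<Rightarrow> 'b::field"
  assumes "finite I" "finite C"
  obtains R where "R \<subseteq> I" "card R \<le> card C"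
    "\<And>i. i \<in> I \<Longrightarrow> \<exists>m. \<forall>c\<in>C. f i c = (\<Sum>s\<in>R. m s * f s c)"
proof -
  define P where "P R \<longleftrightarrow> R \<subseteq> I \<and> (\<forall>i\<in>I. \<exists>m. \<forall>c\<in>C. f i c = (\<Sum>s\<in>R. m s * f s c))" for R
  have "P I" unfolding P_def
  proof (intro conjI ballI subset_refl)
    fix i assume "i \<in> I"
    then have "\<forall>c\<in>C. f i c = (\<Sum>s\<in>I. (if s = i then 1 else 0) * f s c)"
      using assms(1) by (simp add: if_distrib[of "\<lambda>x. x * _"] cong: if_cong)
    then show "\<exists>m. \<forall>c\<in>C. f i c = (\<Sum>s\<in>I. m s * f s c)"
      by (rule exI[where x = "\<lambda>s. if s = i then 1 else 0"])
  qed
  then obtain R where R: "P R" "\<And>Q. P Q \<Longrightarrow> card R \<le> card Q"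
    using ex_has_least_nat[of P I card] by auto
  have finR: "finite R" using R(1) assms(1) by (auto simp: P_def intro: finite_subset)
  have "card R \<le> card C"
  proof (rule ccontr)
    assume "\<not> card R \<le> card C"
    then obtain x p where p: "p \<in> R" "x p \<noteq> 0" "\<And>c. c \<in> C \<Longrightarrow> (\<Sum>s\<in>R. x s * f s c) = 0"
      using homogeneous_system_solution[OF assms(2) finR, of f] by auto
    have fp: "f p c = (\<Sum>s\<in>R - {p}. (- x s / x p) * f s c)" if "c \<in> C" for c
    proof -
      have "x p * f p c + (\<Sum>s\<in>R - {p}. x s * f s c) = 0"
        using p(3)[OF that] finR p(1) by (simp add: sum.remove)
      then have "f p c = - (\<Sum>s\<in>R - {p}. x s * f s c) / x p"
        using p(2) by (simp add: field_simps eq_neg_iff_add_eq_0)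
      then show ?thesis by (simp add: sum_negf sum_divide_distrib)
    qed
    have "P (R - {p})" unfolding P_def
    proof (intro conjI ballI)
      show "R - {p} \<subseteq> I" using R(1) by (auto simp: P_def)
      fix i assume "i \<in> I"
      then obtain m where m: "\<forall>c\<in>C. f i c = (\<Sum>s\<in>R. m s * f s c)"
        using R(1) unfolding P_def by blast
      have "f i c = (\<Sum>s\<in>R - {p}. (m s - m p * x s / x p) * f s c)" if c: "c \<in> C" for c
      proof -
        have "f i c = m p * f p c + (\<Sum>s\<in>R - {p}. m s * f s c)"
          using m c finR p(1) by (simp add: sum.remove)
        then show ?thesis unfolding fp[OF c]
          by (simp add: sum_distrib_left sum.distrib[symmetric] algebra_simps)
      qed
      then show "\<exists>m. \<forall>c\<in>C. f i c = (\<Sum>s\<in>R - {p}. m s * f s c)" by fast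
    qed
    from R(2)[OF this] show False using card_Diff1_less[OF finR p(1)] by simp
  qed
  with R(1) that show thesis by (auto simp: P_def)
qed

lemma (in vec_space) rank_maximal_indpt_cols:
  assumes A: "A \<in> carrier_mat n nc"
  obtains S where "finite S" "S \<subseteq> set (cols A)" "card S = rank A" "lin_indpt S"
    "set (cols A) \<subseteq> span S"
proof -
  have colsc: "set (cols A) \<subseteq> carrier_vec n" using A cols_dim by blast
  obtain S where S: "finite S" "maximal S (\<lambda>T. T \<subseteq> set (cols A) \<and> lin_indpt T)"
    using maximal_exists_superset[of "set (cols A)" "\<lambda>T. T \<subseteq> set (cols A) \<and> lin_indpt T" "{}"]
      finite_lin_indpt2 by auto
  have Sc: "S \<subseteq> set (cols A)" "lin_indpt S" "S \<subseteq> carrier_vec n"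
    using S(2) colsc by (auto simp: maximal_def)
  have "c \<in> span S" if c: "c \<in> set (cols A)" for c
  proof (rule ccontr)
    assume nc: "c \<notin> span S"
    then have "c \<notin> S" using span_mem[OF Sc(3)] by blast
    moreover have "lin_indpt (S \<union> {c})"
      using lin_dep_iff_in_span[OF Sc(3,2)] c colsc nc \<open>c \<notin> S\<close> by blast
    then have "S \<union> {c} = S" using S(2) c Sc(1) unfolding maximal_def by blast
    ultimately show False by blast
  qed
  then show thesis using that[OF S(1) Sc(1) _ Sc(2)] rank_card_indpt[OF A S(2)] by auto
qed

lemma rank_independent_columns:
  fixes A :: "'a::field mat"
  assumes A: "A \<in> carrier_mat n nc"
  obtains J where "J \<subseteq> {..<nc}" "card J = vec_space.rank n A"
    "\<And>w j. (\<And>i. i < n \<Longrightarrow> (\<Sum>j\<in>J. w j * A $$ (i, j)) = 0) \<Longrightarrow> j \<in> J \<Longrightarrow> w j = 0"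
proof -
  interpret vec_space "TYPE('a)" n .
  obtain S where S: "finite S" "S \<subseteq> set (cols A)" "card S = rank A" "lin_indpt S"
    "set (cols A) \<subseteq> span S"
    by (rule rank_maximal_indpt_cols[OF A])
  have Sc: "S \<subseteq> carrier_vec n" using S(2) A cols_dim by blast
  \<comment> \<open>\<open>S\<close> is a set of vectors, whereas the matrix may repeat columns:
    \<open>J\<close> picks one index for each vector.\<close>
  have "S \<subseteq> col A ` {..<nc}" using S(2) A by (auto simp: cols_def)
  then obtain J where J: "J \<subseteq> {..<nc}" "inj_on (col A) J" "S = col A ` J"
    by (meson subset_image_inj)
  show thesis
  proof (rule that)
    show "J \<subseteq> {..<nc}" by fact
    show "card J = rank A" using S(3) J by (simp add: card_image)
    fix w j assume w: "\<And>i. i < n \<Longrightarrow> (\<Sum>j\<in>J. w j * A $$ (i, j)) = 0" and j: "j \<in> J"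
    define a where "a v = w (the_inv_into J (col A) v)" for v
    have a: "a (col A i) = w i" if "i \<in> J" for i
      using the_inv_into_f_f[OF J(2) that] by (simp add: a_def)
    have "lincomb a S = 0\<^sub>v n"
    proof (rule eq_vecI)
      fix i assume i: "i < dim_vec (0\<^sub>v n :: 'a vec)"
      have "lincomb a S $ i = (\<Sum>v\<in>S. a v * v $ i)" using i Sc by (simp add: lincomb_index)
      also have "\<dots> = (\<Sum>j\<in>J. a (col A j) * col A j $ i)"
        using J(2,3) by (simp add: sum.reindex)
      also have "\<dots> = (\<Sum>j\<in>J. w j * A $$ (i, j))"
        using a i A J(1) by (intro sum.cong) auto
      finally show "lincomb a S $ i = 0\<^sub>v n $ i" using w i by simp
    qed (simp add: lincomb_dim[OF S(1) Sc])
    then have "a (col A j) = 0"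
      using S(4) lin_dep_crit[OF S(1) subset_refl, where a = a and v = "col A j"] j J(3)
    by auto
    then show "w j = 0" using a j by simp
  qed
qed

text \<open>On the basis columns \<open>S\<close>, each row is a combination of the rows in
  \<open>R\<close>. All columns are combinations of \<open>S\<close>, so the same holds for the full
  rows, and a column relation valid in the rows of \<open>R\<close> is valid in every row.\<close>

lemma rank_determining_rows:
  fixes A :: "'a::field mat"
  assumes A: "A \<in> carrier_mat n nc"
  obtains R where "R \<subseteq> {..<n}" "card R \<le> vec_space.rank n A"
    "\<And>J w i. J \<subseteq> {..<nc} \<Longrightarrow> (\<And>s. s \<in> R \<Longrightarrow> (\<Sum>j\<in>J. w j * A $$ (s, j)) = 0) \<Longrightarrow> i < n
      \<Longrightarrow> (\<Sum>j\<in>J. w j * A $$ (i, j)) = 0"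
proof -
  interpret vec_space "TYPE('a)" n .
  obtain S where S: "finite S" "S \<subseteq> set (cols A)" "card S = rank A" "lin_indpt S"
    "set (cols A) \<subseteq> span S"
    by (rule rank_maximal_indpt_cols[OF A])
  have Sc: "S \<subseteq> carrier_vec n" using S(2) A cols_dim by blast
  obtain R where R: "R \<subseteq> {..<n}" "card R \<le> card S"
    "\<And>i. i \<in> {..<n} \<Longrightarrow> \<exists>m. \<forall>c\<in>S. c $ i = (\<Sum>s\<in>R. m s * c $ s)"
    by (fact small_spanning_subfamily[OF finite_lessThan[of n] S(1), of "\<lambda>i c. c $ i"])
  have row: "\<exists>m. \<forall>j<nc. A $$ (i, j) = (\<Sum>s\<in>R. m s * A $$ (s, j))" if i: "i < n" for i
  proof -
    \<comment> \<open>The coefficients \<open>m\<close> come from \<open>S\<close> alone, hence do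
      not depend on the column \<open>j\<close>.\<close>
    obtain m where m: "\<And>c. c \<in> S \<Longrightarrow> c $ i = (\<Sum>s\<in>R. m s * c $ s)" using R(3) i by blast
    have "A $$ (i, j) = (\<Sum>s\<in>R. m s * A $$ (s, j))" if j: "j < nc" for j
    proof -
      have "col A j \<in> set (cols A)" using j A by (auto simp: cols_def)
      then obtain a where a: "col A j = lincomb a S"
        using S(5) finite_span[OF S(1) Sc] by blast
      have e: "A $$ (s, j) = (\<Sum>v\<in>S. a v * v $ s)" if "s < n" for s
        using arg_cong[OF a, of "\<lambda>v. v $ s"] that j A Sc by (simp add: lincomb_index)
      have "A $$ (i, j) = (\<Sum>v\<in>S. \<Sum>s\<in>R. m s * (a v * v $ s))"
        using m by (simp add: e[OF i] sum_distrib_left mult.left_commute)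
      also have "\<dots> = (\<Sum>s\<in>R. m s * A $$ (s, j))"
        using R(1) by (subst sum.swap) (auto simp: e sum_distrib_left intro!: sum.cong)
      finally show ?thesis .
    qed
    then show ?thesis by blast
  qed
  show thesis
  proof (rule that[OF R(1)])
    show "card R \<le> rank A" using R(2) S(3) by simp
    fix J w i assume J: "J \<subseteq> {..<nc}" and i: "i < n"
      and z: "\<And>s. s \<in> R \<Longrightarrow> (\<Sum>j\<in>J. w j * A $$ (s, j)) = 0"
    obtain m where m: "\<And>j. j < nc \<Longrightarrow> A $$ (i, j) = (\<Sum>s\<in>R. m s * A $$ (s, j))"
      using row[OF i] by blast
    have "(\<Sum>j\<in>J. w j * A $$ (i, j)) = (\<Sum>j\<in>J. \<Sum>s\<in>R. m s * (w j * A $$ (s, j)))"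
      using J m by (intro sum.cong) (auto simp: sum_distrib_left mult.left_commute)
    also have "\<dots> = (\<Sum>s\<in>R. m s * (\<Sum>j\<in>J. w j * A $$ (s, j)))"
      by (subst sum.swap) (simp add: sum_distrib_left)
    finally show "(\<Sum>j\<in>J. w j * A $$ (i, j)) = 0" using z by simp
  qed
qed

section \<open>Integer relations and labelled matrices\<close>

text \<open>Adding the multiple \<open>d\<close> of a primitive relation \<open>P\<close> corrects
  the coefficient sum of \<open>v\<close> to 1. The resulting \<open>Q\<close> and \<open>P\<close>
  are primitive, so both hold for \<open>\<alpha>'\<close>, and \<open>v\<close> is \<open>Q\<close>
  minus \<open>d\<close> times \<open>P\<close>.\<close>

lemma integer_relation_transfer:
  fixes \<alpha> \<alpha>' :: "nat \<Rightarrow> 'a::field"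
  assumes eq: "primitive_relations k \<alpha> = primitive_relations k \<alpha>'"
    and ne: "primitive_relations k \<alpha> \<noteq> {}"
    and v: "(\<Sum>t<k. of_int (v t) * \<alpha> t) = 0"
  shows "(\<Sum>t<k. of_int (v t) * \<alpha>' t) = 0"
proof -
  obtain P where P: "P \<in> primitive_relations k \<alpha>" using ne by blast
  define d where "d = 1 - (\<Sum>t<k. v t)"
  define Q where "Q = restrict (\<lambda>t. v t + d * P t) {..<k}"
  have Q: "(\<Sum>t<k. of_int (Q t) * \<beta> t)
      = (\<Sum>t<k. of_int (v t) * \<beta> t) + of_int d * (\<Sum>t<k. of_int (P t) * \<beta> t)"
    for \<beta> :: "nat \<Rightarrow> 'a"
    by (simp add: Q_def sum_distrib_left sum.distrib algebra_simps)
  have "(\<Sum>t<k. Q t) = (\<Sum>t<k. v t) + d * (\<Sum>t<k. P t)"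
    by (simp add: Q_def sum_distrib_left sum.distrib)
  then have "Q \<in> primitive_relations k \<alpha>"
    using P v Q[of \<alpha>] by (simp add: primitive_relations_def d_def) (simp add: Q_def)
  then have "Q \<in> primitive_relations k \<alpha>'" "P \<in> primitive_relations k \<alpha>'"
    using P eq by auto
  then show ?thesis using Q[of \<alpha>'] by (simp add: primitive_relations_def)
qed

text \<open>For fixed \<open>t\<close>, this is the 0/1 matrix that multiplies
  \<open>\<alpha> t\<close> when a labelled matrix is decomposed by the values of its
  entries.\<close>

definition entry_indicator :: "(nat \<Rightarrow> nat \<Rightarrow> nat) \<Rightarrow> nat \<Rightarrow> nat \<Rightarrow> nat \<Rightarrow> int" where
  "entry_indicator l t i j = (if i \<noteq> j \<and> l i j = t then 1 else 0)"

text \<open>Keeping \<open>l\<close> and changing \<open>\<alpha>\<close> to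
  \<open>\<alpha>'\<close> expresses the replacement of entries. Labels instead of values make this
  replacement a plain change of argument.\<close>

definition labelled_mat :: "nat \<Rightarrow> (nat \<Rightarrow> nat \<Rightarrow> nat) \<Rightarrow> (nat \<Rightarrow> 'a::field) \<Rightarrow> 'a mat" where
  "labelled_mat n l \<alpha> = mat n n (\<lambda>(i, j). if i = j then 0 else \<alpha> (l i j))"

lemma labelled_mat_carrier [simp]: "labelled_mat n l \<alpha> \<in> carrier_mat n n"
  by (simp add: labelled_mat_def)

lemma L_matrix_labelled_mat:
  assumes "\<And>i j. l i j < k" "\<alpha> ` {..<k} \<subseteq> L"
  shows "L_matrix L n (labelled_mat n l \<alpha>)"
  using assms by (force simp: L_matrix_def labelled_mat_def)

lemma L_matrix_labelling:
  assumes "L_matrix (\<alpha> ` {..<k}) n A" "0 < k"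
  obtains l where "\<And>i j. l i j < k" "A = labelled_mat n l \<alpha>"
proof -
  \<comment> \<open>Labels are to be below \<open>k\<close> at all positions; on the diagonal and
    outside the matrix any label will do, which requires \<open>0 < k\<close>.\<close>
  have "\<exists>t<k. i < n \<longrightarrow> j < n \<longrightarrow> i \<noteq> j \<longrightarrow> A $$ (i, j) = \<alpha> t" for i j
  proof (cases "i < n \<and> j < n \<and> i \<noteq> j")
    case True
    then have "A $$ (i, j) \<in> \<alpha> ` {..<k}" using assms(1) by (simp add: L_matrix_def)
    then show ?thesis by auto
  qed (use assms(2) in auto)
  then obtain l where l: "\<And>i j. l i j < k"
    "\<And>i j. i < n \<Longrightarrow> j < n \<Longrightarrow> i \<noteq> j \<Longrightarrow> A $$ (i, j) = \<alpha> (l i j)" by metis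
  have "A = labelled_mat n l \<alpha>"
    using assms(1) l(2) by (intro eq_matI) (auto simp: L_matrix_def labelled_mat_def)
  with l(1) that show thesis by blast
qed

lemma labelled_mat_row_combination:
  assumes l: "\<And>i j. l i j < k" and "J \<subseteq> {..<n}" "i < n"
  shows "(\<Sum>j\<in>J. of_int (x j) * labelled_mat n l \<alpha> $$ (i, j))
    = (\<Sum>t<k. of_int (\<Sum>j\<in>J. x j * entry_indicator l t i j) * \<alpha> t)"
proof -
  have "labelled_mat n l \<alpha> $$ (i, j) = (\<Sum>t<k. of_int (entry_indicator l t i j) * \<alpha> t)"
    if "j \<in> J" for j
  proof (cases "i = j")
    case False
    have "(\<Sum>t<k. of_int (entry_indicator l t i j) * \<alpha> t) = (\<Sum>t<k. if l i j = t then \<alpha> t else 0)"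
      using False by (intro sum.cong) (auto simp: entry_indicator_def)
    then show ?thesis using False that assms by (auto simp: labelled_mat_def)
  qed (use that assms in \<open>auto simp: labelled_mat_def entry_indicator_def\<close>)
  then have "(\<Sum>j\<in>J. of_int (x j) * labelled_mat n l \<alpha> $$ (i, j))
      = (\<Sum>j\<in>J. \<Sum>t<k. of_int (x j * entry_indicator l t i j) * \<alpha> t)"
    by (simp add: sum_distrib_left mult.assoc)
  also have "\<dots> = (\<Sum>t<k. \<Sum>j\<in>J. of_int (x j * entry_indicator l t i j) * \<alpha> t)"
    by (rule sum.swap)
  finally show ?thesis by (simp add: sum_distrib_right)
qed

text \<open>Annihilating the indicators label by label in the rows of \<open>R\<close> annihilates
  those rows of the matrix, hence all rows. The price is a factor \<open>k\<close> in the number of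
  equations; the gain is that they are integral and do not involve \<open>\<alpha>\<close>.\<close>

lemma labelled_mat_relations:
  fixes \<alpha> :: "nat \<Rightarrow> 'a::field"
  assumes l: "\<And>i j. l i j < k"
  obtains R where "R \<subseteq> {..<n}" "card R \<le> vec_space.rank n (labelled_mat n l \<alpha>)"
    "\<And>J x i. J \<subseteq> {..<n}
      \<Longrightarrow> (\<And>s t. s \<in> R \<Longrightarrow> t < k \<Longrightarrow> (\<Sum>j\<in>J. x j * entry_indicator l t s j) = 0) \<Longrightarrow> i < n
      \<Longrightarrow> (\<Sum>t<k. of_int (\<Sum>j\<in>J. x j * entry_indicator l t i j) * \<alpha> t) = 0"
proof -
  obtain R where R: "R \<subseteq> {..<n}" "card R \<le> vec_space.rank n (labelled_mat n l \<alpha>)"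
    "\<And>J w i. J \<subseteq> {..<n} \<Longrightarrow> (\<And>s. s \<in> R \<Longrightarrow> (\<Sum>j\<in>J. w j * labelled_mat n l \<alpha> $$ (s, j)) = 0)
      \<Longrightarrow> i < n \<Longrightarrow> (\<Sum>j\<in>J. w j * labelled_mat n l \<alpha> $$ (i, j)) = 0"
    by (fact rank_determining_rows[OF labelled_mat_carrier[of n l \<alpha>]])
  show thesis
  proof (rule that[OF R(1,2)])
    fix J x i
    assume J: "J \<subseteq> {..<n}" and i: "i < n"
      and z: "\<And>s t. s \<in> R \<Longrightarrow> t < k \<Longrightarrow> (\<Sum>j\<in>J. x j * entry_indicator l t s j) = 0"
    note c = labelled_mat_row_combination[of l k J n _ x \<alpha>, OF l J]
    have "(\<Sum>j\<in>J. of_int (x j) * labelled_mat n l \<alpha> $$ (s, j)) = 0" if "s \<in> R" for s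
      using c[of s] z[OF that] R(1) that by (subst c) (auto simp del: of_int_sum)
    from R(3)[OF J this i] c[OF i]
    show "(\<Sum>t<k. of_int (\<Sum>j\<in>J. x j * entry_indicator l t i j) * \<alpha> t) = 0" by simp
  qed
qed

section \<open>Rank after replacing the entries, and size without a primitive relation\<close>

text \<open>If the new matrix had too many independent columns \<open>J\<close>, some coprime
  integer \<open>x\<close> on \<open>J\<close> would give a relation on \<open>\<alpha>\<close> in
  every row. By \<open>rel\<close> it transfers to \<open>\<alpha>'\<close>, making the columns in
  \<open>J\<close> dependent.\<close>

lemma rank_labelled_mat_le:
  fixes \<alpha> \<alpha>' :: "nat \<Rightarrow> 'a::field"
  assumes l: "\<And>i j. l i j < k"
    and rel: "\<And>v. (\<Sum>t<k. of_int (v t) * \<alpha> t) = 0 \<Longrightarrow> (\<Sum>t<k. of_int (v t) * \<alpha>' t) = 0"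
  shows "vec_space.rank n (labelled_mat n l \<alpha>') \<le> k * vec_space.rank n (labelled_mat n l \<alpha>)"
proof (rule ccontr)
  assume big: "\<not> ?thesis"
  obtain R where R: "R \<subseteq> {..<n}" "card R \<le> vec_space.rank n (labelled_mat n l \<alpha>)"
    "\<And>J x i. J \<subseteq> {..<n}
      \<Longrightarrow> (\<And>s t. s \<in> R \<Longrightarrow> t < k \<Longrightarrow> (\<Sum>j\<in>J. x j * entry_indicator l t s j) = 0) \<Longrightarrow> i < n
      \<Longrightarrow> (\<Sum>t<k. of_int (\<Sum>j\<in>J. x j * entry_indicator l t i j) * \<alpha> t) = 0"
    by (fact labelled_mat_relations[of l k n \<alpha>, OF l])
  obtain J where J: "J \<subseteq> {..<n}" "card J = vec_space.rank n (labelled_mat n l \<alpha>')"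
    "\<And>w j. (\<And>i. i < n \<Longrightarrow> (\<Sum>j\<in>J. w j * labelled_mat n l \<alpha>' $$ (i, j)) = 0) \<Longrightarrow> j \<in> J
      \<Longrightarrow> w j = 0"
    by (fact rank_independent_columns[OF labelled_mat_carrier[of n l \<alpha>']])
  have fin: "finite R" "finite J" using R(1) J(1) by (auto intro: finite_subset)
  have "card (R \<times> {..<k}) \<le> k * vec_space.rank n (labelled_mat n l \<alpha>)"
    using mult_le_mono1[OF R(2), of k]
    by (simp only: card_cartesian_product card_lessThan mult.commute)
  then have "card (R \<times> {..<k}) < card J" using big J(2) by simp
  then obtain x c where
    x: "\<And>p. p \<in> R \<times> {..<k} \<Longrightarrow> (\<Sum>j\<in>J. x j * entry_indicator l (snd p) (fst p) j) = 0"
    and c: "(\<Sum>j\<in>J. c j * x j) = 1"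
    using integer_system_coprime_solution[of "R \<times> {..<k}" J
        "\<lambda>j p. entry_indicator l (snd p) (fst p) j"] fin by blast
  have "(\<Sum>j\<in>J. of_int (x j) * labelled_mat n l \<alpha>' $$ (i, j)) = 0" if i: "i < n" for i
    using rel[OF R(3)[OF J(1) _ i, of x]] x
      labelled_mat_row_combination[of l k J n i x \<alpha>', OF l J(1) i]
    by force
  then have "of_int (x j) = (0::'a)" if "j \<in> J" for j
    using that by (intro J(3)[of "\<lambda>j. of_int (x j)" j])
  \<comment> \<open>In positive characteristic the images of nonzero integers may vanish;
    coprimality turns their simultaneous vanishing into 1 = 0.\<close>
  then have "of_int (\<Sum>j\<in>J. c j * x j) = (0::'a)" by simp
  then show False unfolding c by simp
qed

lemma no_primitive_relation_size_bound:
  fixes \<alpha> :: "nat \<Rightarrow> 'a::field"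
  assumes l: "\<And>i j. l i j < k" and none: "primitive_relations k \<alpha> = {}"
  shows "n \<le> k * vec_space.rank n (labelled_mat n l \<alpha>) + 1"
proof (rule ccontr)
  assume big: "\<not> ?thesis"
  obtain R where R: "R \<subseteq> {..<n}" "card R \<le> vec_space.rank n (labelled_mat n l \<alpha>)"
    "\<And>J x i. J \<subseteq> {..<n}
      \<Longrightarrow> (\<And>s t. s \<in> R \<Longrightarrow> t < k \<Longrightarrow> (\<Sum>j\<in>J. x j * entry_indicator l t s j) = 0) \<Longrightarrow> i < n
      \<Longrightarrow> (\<Sum>t<k. of_int (\<Sum>j\<in>J. x j * entry_indicator l t i j) * \<alpha> t) = 0"
    by (fact labelled_mat_relations[of l k n \<alpha>, OF l])
  have fin: "finite R" using R(1) by (auto intro: finite_subset)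
  \<comment> \<open>The additional index \<open>None\<close> stands for the equation \<open>\<Sum>\<^sub>j x\<^sub>j = 0\<close>.\<close>
  define T where "T = insert None (Some ` (R \<times> {..<k}))"
  define a where
    "a j p = (case p of None \<Rightarrow> 1 | Some (s, t) \<Rightarrow> entry_indicator l t s j)" for j p
  have "card T = card R * k + 1"
    using fin by (simp add: T_def card_image)
  moreover have "card R * k \<le> k * vec_space.rank n (labelled_mat n l \<alpha>)"
    using mult_le_mono1[OF R(2), of k] by (simp only: mult.commute)
  ultimately have "card T < card {..<n}" using big unfolding card_lessThan by linarith
  moreover have "finite T" using fin by (simp add: T_def)
  ultimately obtain x c where x: "\<And>p. p \<in> T \<Longrightarrow> (\<Sum>j<n. x j * a j p) = 0"
    and c: "(\<Sum>j<n. c j * x j) = 1"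
    using integer_system_coprime_solution[of T "{..<n}" a] by blast
  have x0: "(\<Sum>j<n. x j) = 0" using x[of None] by (simp add: T_def a_def)
  have xR: "(\<Sum>j<n. x j * entry_indicator l t s j) = 0" if "s \<in> R" "t < k" for s t
    using x[of "Some (s, t)"] that by (simp add: T_def a_def)
  define v where "v i t = (\<Sum>j<n. x j * entry_indicator l t i j)" for i t
  have v: "(\<Sum>t<k. of_int (v i t) * \<alpha> t) = 0" if "i < n" for i
    unfolding v_def using R(3)[OF subset_refl xR that] by blast
  \<comment> \<open>Each off-diagonal position of row \<open>i\<close> carries exactly one label and
    the diagonal none, so summing over labels counts every \<open>x j\<close> except
    \<open>x i\<close>.\<close>
  have sum_v: "(\<Sum>t<k. v i t) = - x i" if i: "i < n" for i
  proof -
    have "(\<Sum>t<k. v i t) = (\<Sum>j<n. x j * (\<Sum>t<k. entry_indicator l t i j))"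
      unfolding v_def by (subst sum.swap) (simp add: sum_distrib_left)
    also have "\<dots> = (\<Sum>j<n. x j * (if j = i then 0 else 1))"
      using l by (intro sum.cong) (auto simp: entry_indicator_def)
    also have "\<dots> = (\<Sum>j\<in>{..<n} - {i}. x j)"
      by (intro sum.mono_neutral_cong_right) auto
    also have "\<dots> = - x i" using x0 i by (simp add: sum_diff1)
    finally show ?thesis .
  qed
  \<comment> \<open>The Bezout coefficients combine the row relations; the minus sign cancels that
    of \<open>sum_v\<close>, so the total becomes the sum of \<open>c i * x i\<close>, which is
    1.\<close>
  define P where "P = restrict (\<lambda>t. - (\<Sum>i<n. c i * v i t)) {..<k}"
  have "(\<Sum>t<k. P t) = - (\<Sum>t<k. \<Sum>i<n. c i * v i t)"
    by (simp add: P_def sum_negf)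
  also have "\<dots> = - (\<Sum>i<n. c i * (\<Sum>t<k. v i t))"
    by (subst sum.swap) (simp add: sum_distrib_left)
  also have "\<dots> = 1" using c by (simp add: sum_v sum_negf)
  finally have "(\<Sum>t<k. P t) = 1" .
  have "(\<Sum>t<k. of_int (P t) * \<alpha> t)
      = - (\<Sum>t<k. \<Sum>i<n. of_int (c i) * (of_int (v i t) * \<alpha> t))"
    by (simp add: P_def sum_negf sum_distrib_right mult.assoc)
  also have "\<dots> = - (\<Sum>i<n. of_int (c i) * (\<Sum>t<k. of_int (v i t) * \<alpha> t))"
    by (subst sum.swap) (simp add: sum_distrib_left)
  finally have "(\<Sum>t<k. of_int (P t) * \<alpha> t) = 0" by (simp add: v)
  with \<open>(\<Sum>t<k. P t) = 1\<close> have "P \<in> primitive_relations k \<alpha>" by (simp add: primitive_relations_def P_def)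
  with none show False by blast
qed

section \<open>Comparison of the values of \<open>N\<close>\<close>

lemma N_witness:
  assumes "finite L" "0 \<notin> L"
  obtains A where "L_matrix L (N r L) A" "vec_space.rank (N r L) A \<le> r"
proof -
  have "N r L \<in> L_matrix_sizes r L" unfolding N_def
    using finite_L_matrix_sizes[OF assms, of r] L_matrix_sizes_nonempty[of r L]
    by (intro Max_in) auto
  with that show thesis by (auto simp: L_matrix_sizes_def)
qed

lemma N_geI:
  assumes "finite L" "0 \<notin> L" "L_matrix L n A" "vec_space.rank n A \<le> r"
  shows "n \<le> N r L"
  unfolding N_def using finite_L_matrix_sizes[OF assms(1,2)] assms(3,4)
  by (intro Max_ge) (auto simp: L_matrix_sizes_def)

text \<open>This yields \<open>N\<close> at least 1 even for rank bound 0, as needed when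
  \<open>k = 0\<close> or \<open>r = 0\<close>.\<close>

lemma L_matrix_1: "L_matrix L 1 (0\<^sub>m 1 1)" "vec_space.rank 1 (0\<^sub>m 1 1 :: 'a::field mat) = 0"
  by (simp_all add: L_matrix_def vec_space.rank_0I)

lemma L_matrix_empty_size:
  assumes "L_matrix {} n A"
  shows "n \<le> 1"
proof (rule ccontr)
  assume "\<not> n \<le> 1"
  then have "(0::nat) < n" "1 < n" by auto
  with assms show False unfolding L_matrix_def by (metis empty_iff zero_neq_one)
qed

lemma N_le_N:
  fixes \<alpha> \<alpha>' :: "nat \<Rightarrow> 'a::field"
  assumes nz: "0 \<notin> \<alpha> ` {..<k}" "0 \<notin> \<alpha>' ` {..<k}"
    and eq: "primitive_relations k \<alpha> = primitive_relations k \<alpha>'"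
  shows "N r (\<alpha> ` {..<k}) \<le> N (2 * k * r) (\<alpha>' ` {..<k})"
proof -
  define n where "n = N r (\<alpha> ` {..<k})"
  have fin: "finite (\<alpha> ` {..<k})" "finite (\<alpha>' ` {..<k})" by auto
  note geI = N_geI[OF fin(2) nz(2)]
  obtain A where A: "L_matrix (\<alpha> ` {..<k}) n A" "vec_space.rank n A \<le> r"
    using N_witness[OF fin(1) nz(1)] n_def by metis
  have ge1: "1 \<le> N (2 * k * r) (\<alpha>' ` {..<k})"
    by (rule geI[OF L_matrix_1(1)]) (simp only: L_matrix_1(2) le0)
  have "n \<le> N (2 * k * r) (\<alpha>' ` {..<k})"
  proof (cases "k = 0")
    case True
    then show ?thesis using L_matrix_empty_size A(1) ge1 by force
  next
    case False
    then obtain l where l: "\<And>i j. l i j < k" "A = labelled_mat n l \<alpha>"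
      using L_matrix_labelling[OF A(1)] by auto
    have L': "L_matrix (\<alpha>' ` {..<k}) m (labelled_mat m l \<alpha>')" for m
      using l(1) by (intro L_matrix_labelled_mat) auto
    have kr: "k * vec_space.rank n (labelled_mat n l \<alpha>) \<le> k * r" using A(2) l(2) by simp
    show ?thesis
    proof (cases "primitive_relations k \<alpha> = {}")
      case True
      have n: "n \<le> k * r + 1"
        using no_primitive_relation_size_bound[of l k \<alpha> n, OF l(1) True] kr by linarith
      show ?thesis
      proof (cases "r = 0")
        case True
        then show ?thesis using n ge1 by simp
      next
        case False
        then have "1 \<le> k * r" using \<open>k \<noteq> 0\<close> by simp
        \<comment> \<open>The factor 2 absorbs the additive 1 of the size bound. Now any
          \<open>n\<close> by \<open>n\<close> matrix with entries from \<open>\<alpha>'\<close>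
          will do, because its rank is at most \<open>n\<close>.\<close>
        then have "n \<le> 2 * k * r" using n by linarith
        moreover have "vec_space.rank n (labelled_mat n l \<alpha>') \<le> n"
          by (rule vec_space.rank_le_nc) simp
        ultimately show ?thesis by (intro geI[OF L']) linarith
      qed
    next
      case False
      have "vec_space.rank n (labelled_mat n l \<alpha>') \<le> k * r"
        using kr
          rank_labelled_mat_le[of l k \<alpha> \<alpha>' n, OF l(1) integer_relation_transfer[OF eq False]]
        by linarith
      then show ?thesis by (intro geI[OF L']) linarith
    qed
  qed
  then show ?thesis by (simp add: n_def)
qed

theorem theorem8:
  fixes L L' :: "'a::field set" and \<alpha> \<alpha>' :: "nat \<Rightarrow> 'a" and k :: nat
  assumes "bij_betw \<alpha> {..<k} L" and "bij_betw \<alpha>' {..<k} L'"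
    and "0 \<notin> L" and "0 \<notin> L'"
    and "primitive_relations k \<alpha> = primitive_relations k \<alpha>'"
  shows "\<forall>r. N r L \<le> N (2 * k * r) L' \<and> N r L' \<le> N (2 * k * r) L"
proof -
  have "L = \<alpha> ` {..<k}" "L' = \<alpha>' ` {..<k}"
    using assms(1,2) by (auto simp: bij_betw_def)
  then show ?thesis
    using N_le_N[of \<alpha> k \<alpha>'] N_le_N[of \<alpha>' k \<alpha>] assms(3-5) by simp
qed

end
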